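(* Let $P(z)\in\mathbb{C}[z]$ be a non-constant polynomial. Then the lemniscate $\{z\in\mathbb{C} : |P(z)|=1\}$, regarded as a subset of $\mathbb{R}^2$ via the identification $(x,y)\leftrightarrow x+iy$, is an irreducible real algebraic curve; that is, there exists a polynomial $g(x,y)\in\mathbb{R}[x,y]$ which is irreducible as an element of $\mathbb{C}[x,y]$ and such that $$\{(x,y)\in\mathbb{R}^2 : |P(x+iy)|=1\}=\{(x,y)\in\mathbb{R}^2 : g(x,y)=0\}.$$
   Context: A lemniscate is a real curve in $\mathbb{C}$ given by the equation $|P(z)|=1$, where $P(z)$ is a non-constant polynomial with complex coefficients. A subset of $\mathbb{R}^2$ is called an irreducible real algebraic curve if it is the zero set (in $\mathbb{R}^2$) of a polynomial in two variables with real coefficients that is irreducible over $\mathbb{C}$. *)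

theory Defs
  imports Complex_Main "HOL-Computational_Algebra.Polynomial"
begin

text \<open>
  The ring \<open>R[x,y]\<close> is represented as \<open>R[x][y]\<close>, i.e. by the type \<open>'a poly poly\<close>:
  the outer indeterminate is \<open>y\<close> and the coefficients are polynomials in \<open>x\<close>.
\<close>

definition poly_xy :: "'a::comm_semiring_1 poly poly \<Rightarrow> 'a \<Rightarrow> 'a \<Rightarrow> 'a" where
  "poly_xy g x y = poly (poly g [:y:]) x"

definition complexify :: "real poly poly \<Rightarrow> complex poly poly" where
  "complexify g = map_poly (map_poly complex_of_real) g"

definition irreducible_real_algebraic_curve :: "(real \<times> real) set \<Rightarrow> bool" where
  "irreducible_real_algebraic_curve S \<longleftrightarrow>
     (\<exists>g :: real poly poly. irreducible (complexify g) \<and> S = {(x, y). poly_xy g x y = 0})"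

definition lemniscate :: "complex poly \<Rightarrow> complex set" where
  "lemniscate P = {z. cmod (poly P z) = 1}"

lemma poly_xy_sum:
  "poly_xy g x y = (\<Sum>j\<le>degree g. \<Sum>i\<le>degree (coeff g j). coeff (coeff g j) i * x ^ i * y ^ j)"
proof -
  have "poly_xy g x y = (\<Sum>j\<le>degree g. poly (coeff g j) x * y ^ j)"
    unfolding poly_xy_def by (simp add: poly_altdef[of g] poly_sum)
  then show ?thesis
    by (simp add: poly_altdef sum_distrib_right)
qed

lemma coeff_complexify:
  "coeff (coeff (complexify g) j) i = complex_of_real (coeff (coeff g j) i)"
  by (simp add: complexify_def coeff_map_poly)

end

theory Submission
  imports Defs "HOL-Computational_Algebra.Fundamental_Theorem_Algebra"
begin

text \<open>
  In the coordinates \<open>s = x + iy\<close>, \<open>t = x - iy\<close> the lemniscate has the equation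
  \<open>R(s) Q(t) = 1\<close>, where \<open>Q\<close> is the complex conjugate of \<open>R\<close>; replacing \<open>P = R\<^sup>k\<close> by \<open>R\<close> we may
  assume that \<open>R\<close> is not a proper power. Let \<open>n = deg Q = deg R\<close> and let \<open>A\<close> be a factor of
  \<open>R(s) Q(t) - 1\<close>, of degree \<open>b\<close> in \<open>t\<close> and with leading coefficient \<open>L(s)\<close>. Comparing two
  expressions for the resultant of \<open>A\<close> and \<open>Q\<close> with respect to \<open>t\<close> gives \<open>L\<^sup>n = C R\<^sup>b\<close> with a
  constant \<open>C\<close>. Hence \<open>n\<close> divides \<open>b\<close>, so \<open>b\<close> is \<open>0\<close> or \<open>n\<close>, and \<open>A\<close> or its cofactor is constant.
\<close>

section \<open>Evaluation of polynomials in two variables\<close>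

lemma poly_xy_add [simp]: "poly_xy (A + B) x y = poly_xy A x y + poly_xy B x y"
  by (simp add: poly_xy_def)

lemma poly_xy_mult [simp]: "poly_xy (A * B) x y = poly_xy A x y * poly_xy B x y"
  by (simp add: poly_xy_def)

lemma poly_xy_diff [simp]:
  "poly_xy (A - B) x y = poly_xy A x y - poly_xy B (x :: 'a :: comm_ring_1) y"
  by (simp add: poly_xy_def)

lemma poly_xy_0 [simp]: "poly_xy 0 x y = 0"
  by (simp add: poly_xy_def)

lemma poly_xy_1 [simp]: "poly_xy 1 x y = 1"
  by (simp add: poly_xy_def)

lemma poly_xy_pCons [simp]: "poly_xy (pCons a A) x y = poly a x + y * poly_xy A x y"
  by (simp add: poly_xy_def)

lemma poly_xy_smult [simp]: "poly_xy (smult a A) x y = poly a x * poly_xy A x y"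
  by (simp add: poly_xy_def)

lemma poly_eqI_infinite:
  fixes p q :: "'a :: idom poly"
  assumes "infinite S" "\<And>x. x \<in> S \<Longrightarrow> poly p x = poly q x"
  shows "p = q"
proof (rule ccontr)
  assume "p \<noteq> q"
  then have "finite {x. poly (p - q) x = 0}"
    by (intro poly_roots_finite) simp
  moreover have "S \<subseteq> {x. poly (p - q) x = 0}"
    using assms(2) by auto
  ultimately show False
    using assms(1) finite_subset by blast
qed

text \<open>The one-variable principle is applied twice, in \<open>x\<close> and then to the outer
  polynomial at the infinitely many points \<open>[:y:]\<close>. It allows a complex identity to be
  checked at real points only.\<close>

lemma poly_xy_eqI_infinite:
  fixes A B :: "'a :: idom poly poly"
  assumes "infinite S" "\<And>x y. x \<in> S \<Longrightarrow> y \<in> S \<Longrightarrow> poly_xy A x y = poly_xy B x y"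
  shows "A = B"
proof (rule poly_eqI_infinite)
  show "infinite ((\<lambda>y. [:y:]) ` S)"
    using assms(1) by (auto simp: finite_image_iff inj_on_def)
  fix p assume "p \<in> (\<lambda>y. [:y:]) ` S"
  then show "poly A p = poly B p"
    using assms by (auto intro!: poly_eqI_infinite simp: poly_xy_def)
qed

lemma poly_xy_eqI:
  fixes A B :: "'a :: {idom, ring_char_0} poly poly"
  assumes "\<And>x y. poly_xy A x y = poly_xy B x y"
  shows "A = B"
  using assms by (intro poly_xy_eqI_infinite[of UNIV]) (auto simp: infinite_UNIV_char_0)

section \<open>Substitution, base change and irreducibility\<close>

lemma poly_subst_poly_xy:
  "\<exists>A. \<forall>s t. poly_xy A s t = poly p (poly_xy X s t)"
proof (induction p)
  case 0
  show ?case by (auto intro!: exI[of _ 0])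
next
  case (pCons a p)
  then obtain A where "\<forall>s t. poly_xy A s t = poly p (poly_xy X s t)" by blast
  then show ?case by (auto intro!: exI[of _ "[:[:a:]:] + X * A"])
qed

lemma poly_xy_subst:
  "\<exists>B. \<forall>s t. poly_xy B s t = poly_xy A (poly_xy X s t) (poly_xy Y s t)"
proof (induction A)
  case 0
  show ?case by (auto intro!: exI[of _ 0])
next
  case (pCons a A)
  then obtain B where "\<forall>s t. poly_xy B s t = poly_xy A (poly_xy X s t) (poly_xy Y s t)" by blast
  moreover obtain C where "\<forall>s t. poly_xy C s t = poly a (poly_xy X s t)"
    using poly_subst_poly_xy by blast
  ultimately show ?case by (auto intro!: exI[of _ "C + Y * B"])
qed

lemma poly_xy_complexify:
  "poly_xy (complexify g) (of_real x) (of_real y) = of_real (poly_xy g x y)"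
proof -
  have *: "poly (map_poly complex_of_real p) (of_real x) = of_real (poly p x)" for p
    by (induction p) (auto simp: map_poly_pCons)
  show ?thesis
    by (induction g) (auto simp: complexify_def map_poly_pCons * )
qed

text \<open>Together with its converse below, this describes units by their values, so that they can
  be followed through a substitution.\<close>

lemma is_unit_poly_xy_const:
  fixes A :: "'a :: {field, ring_char_0} poly poly"
  assumes "A \<noteq> 0" "\<And>x y. poly_xy A x y = c"
  shows "is_unit A"
proof -
  have "A = [:[:c:]:]"
    using assms(2) by (intro poly_xy_eqI) simp
  with assms(1) show ?thesis
    by (auto simp: is_unit_const_poly_iff dvd_field_iff)
qed

lemma is_unit_imp_poly_xy_const:
  fixes A :: "'a :: idom poly poly"
  assumes "A dvd 1"
  shows "\<exists>c. \<forall>x y. poly_xy A x y = c"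
proof -
  obtain p where p: "A = [:p:]" "p dvd 1"
    using assms is_unit_poly_iff by blast
  obtain c where "p = [:c:]"
    using p(2) is_unit_poly_iff by blast
  with p(1) show ?thesis by auto
qed

text \<open>A factorization of \<open>G\<close> pulls back along \<open>(X, Y)\<close> to one of
  \<open>F\<close>, where one factor is constant. As \<open>(X', Y')\<close> is a right inverse of
  \<open>(X, Y)\<close>, the corresponding factor of \<open>G\<close> is constant too.\<close>

lemma irreducible_poly_xy_subst:
  fixes F G X Y X' Y' :: "'a :: {field, ring_char_0} poly poly"
  assumes F: "irreducible F"
    and FG: "\<And>s t. poly_xy F s t = poly_xy G (poly_xy X s t) (poly_xy Y s t)"
    and X': "\<And>x y. poly_xy X (poly_xy X' x y) (poly_xy Y' x y) = x"
    and Y': "\<And>x y. poly_xy Y (poly_xy X' x y) (poly_xy Y' x y) = y"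
  shows "irreducible G"
proof -
  have GF: "poly_xy G x y = poly_xy F (poly_xy X' x y) (poly_xy Y' x y)" for x y
    by (simp add: FG X' Y')
  have "F \<noteq> 0" "\<not> is_unit F"
    using F by (auto simp: irreducible_def)
  show ?thesis
  proof (rule irreducibleI)
    show "G \<noteq> 0"
    proof
      assume "G = 0"
      then have "F = 0" by (intro poly_xy_eqI) (simp add: FG)
      with \<open>F \<noteq> 0\<close> show False by simp
    qed
    then show "\<not> is_unit G"
      using is_unit_poly_xy_const[OF \<open>F \<noteq> 0\<close>] \<open>\<not> is_unit F\<close> FG
      by (metis is_unit_imp_poly_xy_const)
    fix A B assume AB: "G = A * B"
    obtain A' where A': "\<And>s t. poly_xy A' s t = poly_xy A (poly_xy X s t) (poly_xy Y s t)"
      using poly_xy_subst by metis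
    obtain B' where B': "\<And>s t. poly_xy B' s t = poly_xy B (poly_xy X s t) (poly_xy Y s t)"
      using poly_xy_subst by metis
    have "F = A' * B'"
      by (rule poly_xy_eqI) (simp add: FG AB A' B')
    then have "is_unit A' \<or> is_unit B'"
      using F irreducibleD by blast
    moreover have "is_unit A" if unit: "is_unit A'"
    proof -
      obtain c where "\<And>s t. poly_xy A' s t = c"
        using is_unit_imp_poly_xy_const[OF unit] by blast
      then have "poly_xy A x y = c" for x y
        using A'[of "poly_xy X' x y" "poly_xy Y' x y"] X' Y' by simp
      then show ?thesis
        using AB \<open>G \<noteq> 0\<close> by (intro is_unit_poly_xy_const) auto
    qed
    moreover have "is_unit B" if unit: "is_unit B'"
    proof -
      obtain c where "\<And>s t. poly_xy B' s t = c"
        using is_unit_imp_poly_xy_const[OF unit] by blast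
      then have "poly_xy B x y = c" for x y
        using B'[of "poly_xy X' x y" "poly_xy Y' x y"] X' Y' by simp
      then show ?thesis
        using AB \<open>G \<noteq> 0\<close> by (intro is_unit_poly_xy_const) auto
    qed
    ultimately show "is_unit A \<or> is_unit B" by blast
  qed
qed

section \<open>Perfect powers and orders of zeros\<close>

lemma order_power:
  fixes p :: "'a :: idom poly"
  assumes "p \<noteq> 0"
  shows "order a (p ^ n) = n * order a p"
  using assms by (induction n) (auto simp: order_mult)

text \<open>In the factorization into linear factors every exponent can be divided by
  \<open>h\<close>, and the leading coefficient has an \<open>h\<close>-th root.\<close>

lemma complex_poly_is_power:
  fixes p :: "complex poly"
  assumes "h > 0" "\<And>a. h dvd order a p"
  shows "\<exists>q. p = q ^ h"
proof -
  obtain c where c: "c ^ h = lead_coeff p"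
    using nth_root_exists[of h "lead_coeff p"] assms(1) by auto
  have "p = smult (lead_coeff p) (\<Prod>z | poly p z = 0. [:-z, 1:] ^ order z p)"
    by (simp add: complex_poly_decompose)
  also have "\<dots> = smult (c ^ h) (\<Prod>z | poly p z = 0. ([:-z, 1:] ^ (order z p div h)) ^ h)"
    using assms(2) by (simp add: c dvd_div_mult_self flip: power_mult)
  also have "\<dots> = smult c (\<Prod>z | poly p z = 0. [:-z, 1:] ^ (order z p div h)) ^ h"
    by (simp add: smult_power prod_power_distrib)
  finally show ?thesis by blast
qed

text \<open>Comparing orders of zeros gives \<open>n * order a L = b * order a R\<close>. After
  cancelling the gcd, \<open>h = n div gcd n b\<close> divides every order of \<open>R\<close>, so
  \<open>R\<close> is an \<open>h\<close>-th power and \<open>h = 1\<close>.\<close>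

lemma dvd_exponent_if_power_eq:
  fixes R L :: "complex poly"
  assumes "R \<noteq> 0" and prim: "\<And>S k. R = S ^ k \<Longrightarrow> k = 1"
    and "n > 0" and eq: "L ^ n = smult C (R ^ b)" and "C \<noteq> 0"
  shows "n dvd b"
proof -
  define h where "h = n div gcd n b"
  have h: "n = h * gcd n b" "coprime h (b div gcd n b)" "h > 0"
    using \<open>n > 0\<close> by (auto simp: h_def div_gcd_coprime dvd_div_eq_0_iff intro!: Nat.gr0I)
  have "h dvd order a R" for a
  proof -
    have "L \<noteq> 0"
      using assms by (auto simp: power_0_left)
    then have "n * order a L = b * order a R"
      using arg_cong[OF eq, of "order a"] \<open>R \<noteq> 0\<close> \<open>C \<noteq> 0\<close>
      by (simp add: order_power order_smult)
    then have "(h * order a L) * gcd n b = ((b div gcd n b) * order a R) * gcd n b"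
      using h(1) by (metis dvd_div_mult_self gcd_dvd2 mult.assoc mult.commute)
    then have "h dvd (b div gcd n b) * order a R"
      using \<open>n > 0\<close> by (metis dvd_triv_left gcd_eq_0_iff mult_cancel2 not_gr_zero)
    then show ?thesis
      using h(2) by (simp add: coprime_dvd_mult_right_iff)
  qed
  then have "h = 1"
    using complex_poly_is_power[OF h(3)] prim by metis
  then show ?thesis
    using h(1) by (metis gcd_dvd2 mult_1)
qed

section \<open>Factors of \<open>R(s) Q(t) - 1\<close>\<close>

text \<open>
  For fixed \<open>s\<close>, \<open>Q = 1 / R(s)\<close> at each root of \<open>A(s, \<cdot>)\<close>, while \<open>A(\<cdot>, r)\<close> is constant for each
  root \<open>r\<close> of \<open>Q\<close>. The conclusion compares the two ways of writing the resultant of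
  \<open>A(s, \<cdot>)\<close> and \<open>Q\<close>.
\<close>
lemma factor_lead_coeff_power:
  fixes R Q :: "complex poly"
  assumes AB: "\<And>s t. poly_xy A s t * poly_xy B s t = poly R s * poly Q t - 1"
    and "Q \<noteq> 0" "A \<noteq> 0"
  shows "\<exists>C. C \<noteq> 0 \<and> lead_coeff A ^ degree Q = smult C (R ^ degree A)"
proof -
  define n b q L where "n = degree Q" and "b = degree A" and "q = lead_coeff Q"
    and "L = lead_coeff A"
  have "q \<noteq> 0" "L \<noteq> 0"
    using assms by (auto simp: q_def L_def)
  obtain r where r: "smult q (\<Prod>i<n. [:- r i, 1:]) = Q"
    unfolding q_def n_def by (rule complex_poly_decompose')
  have Q: "poly Q t = q * (\<Prod>i<n. t - r i)" for t
    by (subst r [symmetric]) (simp add: poly_prod)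
  \<comment> \<open>At a root of \<open>Q\<close> the product of \<open>A\<close> and
    \<open>B\<close> is -1, so \<open>A(s, r i)\<close> is a unit among the polynomials in
    \<open>s\<close>.\<close>
  have "\<exists>k. k \<noteq> 0 \<and> (\<forall>s. poly_xy A s (r i) = k)" if "i < n" for i
  proof -
    have "poly Q (r i) = 0"
      using that by (auto simp: Q)
    then have "poly A [:r i:] * poly B [:r i:] = [:-1:]"
      using AB[of _ "r i"] by (intro poly_eqI_infinite[of UNIV])
        (auto simp: poly_xy_def infinite_UNIV_char_0)
    then have "is_unit (poly A [:r i:])"
      by (intro dvdI[of _ _ "- poly B [:r i:]"]) (simp add: one_pCons)
    then obtain k where "poly A [:r i:] = [:k:]" "k dvd 1"
      using is_unit_polyE by blast
    then show ?thesis
      by (auto simp: poly_xy_def)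
  qed
  then obtain k where k: "\<And>i. i < n \<Longrightarrow> k i \<noteq> 0" "\<And>i s. i < n \<Longrightarrow> poly_xy A s (r i) = k i"
    by metis
  define K where "K = (\<Prod>i<n. k i)"
  have "K \<noteq> 0"
    using k by (auto simp: K_def)
  \<comment> \<open>The sign comes from reversing the \<open>b * n\<close> differences
    \<open>r i - y j\<close>, the power of \<open>q\<close> from evaluating \<open>Q\<close> at the
    \<open>b\<close> roots \<open>y j\<close>.\<close>
  define C where "C = (-1) ^ (b * n) * K * q ^ b"
  \<comment> \<open>Where \<open>L\<close> does not vanish, \<open>A(s, .)\<close> keeps the degree
    \<open>b\<close> and so has \<open>b\<close> roots with multiplicity.\<close>
  have pt: "poly L s ^ n = C * poly R s ^ b" if s: "poly L s \<noteq> 0" for s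
  proof -
    define \<alpha> where "\<alpha> = map_poly (\<lambda>p. poly p s) A"
    have \<alpha>: "poly \<alpha> t = poly_xy A s t" for t
      unfolding \<alpha>_def by (induction A) (auto simp: map_poly_pCons)
    have deg: "degree \<alpha> = b"
      using s by (auto simp: \<alpha>_def b_def L_def map_poly_degree_eq)
    then have lc: "lead_coeff \<alpha> = poly L s"
      by (simp add: \<alpha>_def L_def b_def coeff_map_poly)
    obtain y where "smult (lead_coeff \<alpha>) (\<Prod>j<degree \<alpha>. [:- y j, 1:]) = \<alpha>"
      by (rule complex_poly_decompose')
    then have y: "smult (poly L s) (\<Prod>j<b. [:- y j, 1:]) = \<alpha>"
      by (simp only: lc) (simp only: deg)
    have \<alpha>': "poly \<alpha> t = poly L s * (\<Prod>j<b. t - y j)" for t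
      by (subst y [symmetric]) (simp add: poly_prod)
    have one: "poly R s * (q * (\<Prod>i<n. y j - r i)) = 1" if "j < b" for j
    proof -
      have "poly \<alpha> (y j) = 0"
        using that by (auto simp: \<alpha>')
      then show ?thesis
        using AB[of s "y j"] by (simp add: \<alpha> Q)
    qed
    \<comment> \<open>The product of the values of \<open>A(s, .)\<close> at the roots of
      \<open>Q\<close> is regrouped into values of \<open>Q\<close> at the roots of
      \<open>A(s, .)\<close>, each of which is \<open>1 / R(s)\<close>.\<close>
    have "K = (\<Prod>i<n. poly L s * (\<Prod>j<b. r i - y j))"
      unfolding K_def by (rule prod.cong) (simp_all add: \<alpha> k(2) flip: \<alpha>')
    also have "\<dots> = poly L s ^ n * (\<Prod>i<n. \<Prod>j<b. (-1) * (y j - r i))"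
      by (simp add: prod.distrib)
    also have "(\<Prod>i<n. \<Prod>j<b. (-1) * (y j - r i)) = (-1) ^ (b * n) * (\<Prod>i<n. \<Prod>j<b. y j - r i)"
      by (simp only: prod.distrib prod_constant card_lessThan power_mult)
    also have "(\<Prod>i<n. \<Prod>j<b. y j - r i) = (\<Prod>j<b. \<Prod>i<n. y j - r i)"
      by (rule prod.swap)
    finally have "K * (poly R s ^ b * q ^ b) =
        poly L s ^ n * (-1) ^ (b * n) * (\<Prod>j<b. poly R s * (q * (\<Prod>i<n. y j - r i)))"
      by (simp add: prod.distrib mult_ac)
    also have "\<dots> = poly L s ^ n * (-1) ^ (b * n)"
      using one by simp
    finally have KR: "K * (poly R s ^ b * q ^ b) = poly L s ^ n * (-1) ^ (b * n)" .
    have "C * poly R s ^ b = (-1) ^ (b * n) * (K * (poly R s ^ b * q ^ b))"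
      by (simp add: C_def mult_ac)
    also have "\<dots> = ((-1) ^ (b * n) * (-1) ^ (b * n)) * poly L s ^ n"
      unfolding KR by (simp only: mult_ac)
    finally have "C * poly R s ^ b = ((-1) ^ (b * n) * (-1) ^ (b * n)) * poly L s ^ n" .
    then show ?thesis
      by (simp flip: power_mult_distrib)
  qed
  \<comment> \<open>The extra factor \<open>L\<close> makes the identity trivial at the zeros of
    \<open>L\<close>, which \<open>pt\<close> leaves out.\<close>
  have "L * L ^ n = L * smult C (R ^ b)"
  proof (rule poly_eqI_infinite[of UNIV])
    show "poly (L * L ^ n) s = poly (L * smult C (R ^ b)) s" for s
      using pt[of s] by (cases "poly L s = 0") auto
  qed (simp add: infinite_UNIV_char_0)
  then have "L ^ n = smult C (R ^ b)"
    using \<open>L \<noteq> 0\<close> mult_left_cancel by blast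
  moreover have "C \<noteq> 0"
    using \<open>K \<noteq> 0\<close> \<open>q \<noteq> 0\<close> by (simp add: C_def)
  ultimately show ?thesis
    unfolding n_def b_def L_def by blast
qed

lemma irreducible_separated_product:
  fixes R Q :: "complex poly"
  assumes F: "\<And>s t. poly_xy F s t = poly R s * poly Q t - 1"
    and n: "degree Q > 0" and "degree R > 0"
    and prim: "\<And>S k. R = S ^ k \<Longrightarrow> k = 1"
  shows "irreducible F"
proof -
  have "R \<noteq> 0" "Q \<noteq> 0"
    using assms by auto
  have F_eq: "F = smult R (map_poly (\<lambda>c. [:c:]) Q) - 1"
  proof (rule poly_xy_eqI)
    fix s t
    have "poly (poly (map_poly (\<lambda>c. [:c:]) Q) [:t:]) s = poly Q t"
      by (induction Q) (auto simp: map_poly_pCons)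
    then show "poly_xy F s t = poly_xy (smult R (map_poly (\<lambda>c. [:c:]) Q) - 1) s t"
      by (simp add: F) (simp add: poly_xy_def)
  qed
  have "degree (smult R (map_poly (\<lambda>c. [:c:]) Q)) = degree Q"
    using \<open>R \<noteq> 0\<close> by (simp add: degree_map_poly)
  then have deg: "degree F = degree Q"
    using n degree_add_eq_left[of "-1" "smult R (map_poly (\<lambda>c. [:c:]) Q)"] by (simp add: F_eq)
  have factor: "degree A > 0 \<longrightarrow> degree Q dvd degree A" "degree A = 0 \<Longrightarrow> is_unit A"
    if AB: "F = A * B" for A B
  proof -
    have "A \<noteq> 0"
      using AB deg n by auto
    then obtain C where C: "C \<noteq> 0" "lead_coeff A ^ degree Q = smult C (R ^ degree A)"
      using factor_lead_coeff_power[of A B R Q] \<open>Q \<noteq> 0\<close> F AB by auto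
    then show "degree A > 0 \<longrightarrow> degree Q dvd degree A"
      using dvd_exponent_if_power_eq \<open>R \<noteq> 0\<close> prim n by metis
    assume "degree A = 0"
    then obtain p where p: "A = [:p:]"
      by (elim degree_eq_zeroE)
    \<comment> \<open>For degree 0 in \<open>t\<close> the power of \<open>R\<close> is 1, so
      \<open>p ^ degree Q\<close> is the constant \<open>C\<close>.\<close>
    with C have "degree (p ^ degree Q) = 0"
      by simp
    then have "degree p = 0"
      using n by (cases "p = 0") (auto simp: degree_power_eq)
    with p \<open>A \<noteq> 0\<close> show "is_unit A"
      by (auto simp: is_unit_const_poly_iff dvd_field_iff elim!: degree_eq_zeroE)
  qed
  show ?thesis
  proof (rule irreducibleI)
    show "F \<noteq> 0"
      using deg n by auto
    show "\<not> is_unit F"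
      using deg n by (auto elim: is_unit_polyE)
    fix A B assume AB: "F = A * B"
    \<comment> \<open>Each of the two degrees is 0 or a multiple of their sum
      \<open>degree Q\<close>, so one of them is 0.\<close>
    have "degree Q = degree A + degree B"
      using AB deg n by (metis \<open>F \<noteq> 0\<close> degree_mult_eq mult_eq_0_iff)
    with factor[OF AB] factor[of B A] AB n show "is_unit A \<or> is_unit B"
      by (metis add_eq_self_zero dvd_imp_le le_add1 le_antisym mult.commute neq0_conv)
  qed
qed

section \<open>Reduction to a polynomial that is not a proper power\<close>

text \<open>Take the largest \<open>k\<close> for which \<open>P\<close> is a \<open>k\<close>-th
  power; \<open>degree P\<close> bounds such exponents. Then \<open>R = S ^ m\<close> makes
  \<open>P\<close> an \<open>(m * k)\<close>-th power, which forces \<open>m = 1\<close>.\<close>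

lemma complex_poly_primitive_root:
  fixes P :: "complex poly"
  assumes "degree P > 0"
  obtains R k where "P = R ^ k" "degree R > 0" "\<And>S m. R = S ^ m \<Longrightarrow> m = 1"
proof -
  have bound: "k \<le> degree P \<and> degree S > 0" if "P = S ^ k" for S k
  proof -
    have "S \<noteq> 0"
      using that assms by (cases k) auto
    then have "degree P = k * degree S"
      using that by (simp add: degree_power_eq)
    with assms show ?thesis by (cases "degree S") auto
  qed
  define k where "k = Greatest (\<lambda>k. \<exists>S. P = S ^ k)"
  have "\<exists>S. P = S ^ k"
    unfolding k_def by (rule GreatestI_nat[of _ 1 "degree P"]) (use bound in \<open>auto intro: exI[of _ P]\<close>)
  then obtain R where R: "P = R ^ k" by blast
  have "m = 1" if S: "R = S ^ m" for S m
  proof -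
    have "P = S ^ (m * k)"
      using R S by (simp add: power_mult)
    then have "m * k \<le> k"
      unfolding k_def by (intro Greatest_le_nat[where b = "degree P"]) (use bound in auto)
    moreover have "k > 0"
      using R assms by (cases k) auto
    moreover have "m > 0"
      using S bound[OF R] by (cases m) auto
    ultimately show ?thesis by simp
  qed
  with R bound[OF R] show thesis
    using that by blast
qed

section \<open>The real equation of the lemniscate\<close>

lemma real_imag_parts_poly:
  "\<exists>u v :: real poly poly. \<forall>x y. poly R (Complex x y) = Complex (poly_xy u x y) (poly_xy v x y)"
proof (induction R)
  case 0
  show ?case by (auto intro!: exI[of _ 0] simp: complex_eq_iff)
next
  case (pCons c R)
  then obtain u v :: "real poly poly" where
    uv: "\<And>x y. poly R (Complex x y) = Complex (poly_xy u x y) (poly_xy v x y)"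
    by blast
  show ?case
    \<comment> \<open>These are the real and imaginary parts of \<open>c + (x + iy)(u + iv)\<close>,
      with \<open>[:[:0, 1:]:]\<close> for \<open>x\<close> and \<open>[:0, 1:]\<close> for
      \<open>y\<close>.\<close>
    by (rule exI[of _ "[:[:Re c:]:] + [:[:0, 1:]:] * u - [:0, 1:] * v"],
        rule exI[of _ "[:[:Im c:]:] + [:[:0, 1:]:] * v + [:0, 1:] * u"])
      (simp add: uv complex_eq_iff)
qed

theorem mainTheorem1:
  fixes P :: "complex poly"
  assumes "degree P > 0"
  shows "irreducible_real_algebraic_curve {(x, y). Complex x y \<in> lemniscate P}"
proof -
  obtain R k where R: "P = R ^ k" "degree R > 0" "\<And>S m. R = S ^ m \<Longrightarrow> m = 1"
    using complex_poly_primitive_root[OF assms] by blast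
  have "k > 0"
    using R(1) assms by (cases k) auto
  obtain u v :: "real poly poly" where
    uv: "\<And>x y. poly R (Complex x y) = Complex (poly_xy u x y) (poly_xy v x y)"
    using real_imag_parts_poly by metis
  \<comment> \<open>This is \<open>|R|^2 - 1\<close>. The polynomial \<open>|P|^2 - 1\<close> has
    the same real zeros, but \<open>g\<close> divides it properly when \<open>k > 1\<close>.\<close>
  define g where "g = u * u + v * v - 1"
  have g: "poly_xy g x y = (cmod (poly R (Complex x y)))\<^sup>2 - 1" for x y
    by (simp add: g_def uv cmod_power2)
      (simp add: power2_eq_square)
  have "poly_xy g x y = 0 \<longleftrightarrow> Complex x y \<in> lemniscate P" for x y
  proof -
    have "cmod (poly R (Complex x y)) ^ k = 1 \<longleftrightarrow> cmod (poly R (Complex x y)) = 1"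
      using \<open>k > 0\<close> power_eq_imp_eq_base[of "cmod (poly R (Complex x y))" k 1] by auto
    then show ?thesis
      by (simp add: g lemniscate_def R(1) norm_power power2_eq_1_iff)
        (smt (verit) norm_ge_zero)
  qed
  moreover have "irreducible (complexify g)"
  proof -
    \<comment> \<open>Conjugating the coefficients gives
      \<open>Q(cnj z) = cnj (R(z))\<close>.\<close>
    define Q where "Q = map_poly cnj R"
    \<comment> \<open>\<open>X'\<close> and \<open>Y'\<close> stand for \<open>s = x + iy\<close>
      and \<open>t = x - iy\<close>; \<open>X\<close> and \<open>Y\<close> recover \<open>x\<close>
      and \<open>y\<close> from \<open>s\<close> and \<open>t\<close>.\<close>
    define X Y X' Y' :: "complex poly poly" where
      "X = [:[:0, 1/2:], [:1/2:]:]" and "Y = [:[:0, -\<i>/2:], [:\<i>/2:]:]" and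
      "X' = [:[:0, 1:], [:\<i>:]:]" and "Y' = [:[:0, 1:], [:-\<i>:]:]"
    have XY: "poly_xy X s t = (s + t) / 2" "poly_xy Y s t = \<i> * (t - s) / 2"
      "poly_xy X' s t = s + \<i> * t" "poly_xy Y' s t = s - \<i> * t" for s t
      by (simp_all add: X_def Y_def X'_def Y'_def field_simps)
    obtain p where p: "\<And>s t. poly_xy p s t = poly R (poly_xy [:[:0, 1:]:] s t)"
      using poly_subst_poly_xy by metis
    obtain p' where p': "\<And>s t. poly_xy p' s t = poly Q (poly_xy [:0, 1:] s t)"
      using poly_subst_poly_xy by metis
    define F where "F = p * p' - 1"
    have F: "poly_xy F s t = poly R s * poly Q t - 1" for s t
      by (simp add: F_def p p')
    have "degree Q > 0"
      using R(2) by (simp add: Q_def degree_map_poly)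
    then have "irreducible F"
      using irreducible_separated_product[OF F] R by blast
    obtain G where G: "\<And>x y. poly_xy G x y = poly_xy F (poly_xy X' x y) (poly_xy Y' x y)"
      using poly_xy_subst by metis
    \<comment> \<open>At real points \<open>t\<close> is the conjugate of \<open>s\<close>, so
      \<open>R(s) Q(t)\<close> is \<open>|R(s)|^2\<close>; agreement there determines both
      polynomials.\<close>
    have "complexify g = G"
    proof (rule poly_xy_eqI_infinite)
      show "infinite (range complex_of_real)"
        by (simp add: finite_image_iff inj_on_def infinite_UNIV_char_0)
      fix a b assume "a \<in> range complex_of_real" "b \<in> range complex_of_real"
      then obtain x y where xy: "a = of_real x" "b = of_real y" by blast
      have "poly_xy G a b = poly R (Complex x y) * cnj (poly R (Complex x y)) - 1"
        by (simp add: G F XY xy Q_def Complex_eq)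
      also have "\<dots> = of_real ((cmod (poly R (Complex x y)))\<^sup>2 - 1)"
        by (simp add: complex_norm_square del: of_real_power)
      finally show "poly_xy (complexify g) a b = poly_xy G a b"
        by (simp add: xy poly_xy_complexify g)
    qed
    moreover have "irreducible G"
      by (rule irreducible_poly_xy_subst[OF \<open>irreducible F\<close>, of _ X Y X' Y'])
        (simp_all add: G XY field_simps)
    ultimately show ?thesis by simp
  qed
  ultimately show ?thesis
    unfolding irreducible_real_algebraic_curve_def by (intro exI[of _ g]) auto
qed

end
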